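(* Let $d\geq 1$ and let $D$ be an oriented graph of minimum semi-degree $d$ and of order $n=md$, where $2.91082<m<\frac{2}{c}$. If the strong connectivity $k$ of $D$ satisfies $$k\leq \max \left\lbrace \dfrac{5-m-4c+c^2}{(1-c)(2-c)}\,d,\ \dfrac{2-c m}{2-c}\,d\right\rbrace,$$ then $D$ contains at least one directed triangle.
   Context: Digraphs have no loops and no parallel arcs. An oriented graph is a digraph in which for any two distinct vertices $x,y$ at most one of $(x,y),(y,x)$ is an arc. The minimum semi-degree of $D$ is $\delta^0(D)=\min\{\delta^+(D),\delta^-(D)\}$, the minimum of the minimum out-degree and the minimum in-degree. A set $S$ of vertices disconnects $D$ if $D-S$ is not strongly connected; the strong connectivity $k(D)$ is the smallest cardinality of a vertex set disconnecting $D$. A (directed) triangle is a directed cycle of length $3$. The constant $c$ denotes the minimum constant such that every digraph of order $n$ with minimum out-degree at least $cn$ contains a directed cycle of length at most $3$; it is known that $\frac13\leq c\leq 0.3465$. *)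

theory Defs
  imports Complex_Main "Graph_Theory.Digraph_Component" "Graph_Theory.Arc_Walk"
begin

locale oriented_graph = digraph +
  assumes not_both_arcs: "\<lbrakk>u \<in> verts G; v \<in> verts G; u \<noteq> v\<rbrakk> \<Longrightarrow> \<not> (u \<rightarrow> v \<and> v \<rightarrow> u)"

definition min_out_degree :: "('a, 'b) pre_digraph \<Rightarrow> nat" where
  "min_out_degree G = Min (out_degree G ` verts G)"

definition min_in_degree :: "('a, 'b) pre_digraph \<Rightarrow> nat" where
  "min_in_degree G = Min (in_degree G ` verts G)"

definition min_semi_degree :: "('a, 'b) pre_digraph \<Rightarrow> nat" where
  "min_semi_degree G = min (min_out_degree G) (min_in_degree G)"

definition disconnects :: "('a, 'b) pre_digraph \<Rightarrow> 'a set \<Rightarrow> bool" where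
  "disconnects G S \<longleftrightarrow> S \<subseteq> verts G \<and> \<not> strongly_connected (G \<restriction> (verts G - S))"

text \<open>The null digraph is not \<^const>\<open>strongly_connected\<close>, so the minimum below is over a nonempty
  set for every finite digraph. In an oriented graph with at least two vertices this convention has
  no effect: any two vertices induce a digraph that is not strongly connected, so
  a minimum disconnecting set leaves at least two vertices.\<close>

definition strong_connectivity :: "('a, 'b) pre_digraph \<Rightarrow> nat" where
  "strong_connectivity G = Min (card ` {S. disconnects G S})"

definition has_directed_triangle :: "('a, 'b) pre_digraph \<Rightarrow> bool" where
  "has_directed_triangle G \<longleftrightarrow> (\<exists>p. pre_digraph.cycle G p \<and> length p = 3)"

text \<open>Every finite digraph is isomorphic to one with vertices in \<^typ>\<open>nat\<close> and pairs of vertices as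
  arcs, so it is enough to quantify over these.\<close>

definition forces_short_cycle :: "real \<Rightarrow> bool" where
  "forces_short_cycle x \<longleftrightarrow>
    (\<forall>G :: (nat, nat \<times> nat) pre_digraph.
      digraph G \<and> verts G \<noteq> {} \<and> real (min_out_degree G) \<ge> x * real (card (verts G))
      \<longrightarrow> (\<exists>p. pre_digraph.cycle G p \<and> length p \<le> 3))"

text \<open>The minimum is attained. Let \<open>c\<close> be the infimum; then \<open>c \<ge> 1/3\<close>. If \<open>G\<close> has order \<open>n\<close>,
  minimum out-degree \<open>\<delta> \<ge> c n > 0\<close> and no cycle of length at most 3, then neither has the
  lexicographic product of \<open>G\<close> with itself, whose order is \<open>n^2\<close> and whose minimum out-degree
  is \<open>\<delta> n + \<delta> > c n^2\<close>, contradicting the choice of \<open>c\<close>.\<close>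

definition short_cycle_const :: real where
  "short_cycle_const = (LEAST x. forces_short_cycle x)"

end

theory Submission
  imports Defs
begin

text \<open>
  Suppose there is no directed triangle and let \<open>S\<close> be a minimum cut, so that the vertices split
  into \<open>A\<close>, \<open>S\<close>, \<open>B\<close> without arcs from \<open>B\<close> to \<open>A\<close>. By the choice of \<open>c\<close> every nonempty vertex set \<open>X\<close>
  contains a vertex with fewer than \<open>c |X|\<close> out-neighbours in \<open>X\<close>, and one with fewer than \<open>c |X|\<close>
  in-neighbours in \<open>X\<close>. Applied to \<open>A\<close> and \<open>B\<close> themselves this gives \<open>2 d < c (|A| + |B|) + 2 k\<close>, the
  second bound on \<open>k\<close>. For the first one, take \<open>y\<close> in \<open>A\<close> with few in-neighbours in \<open>A\<close> and apply the
  choice of \<open>c\<close> again to the in-neighbours of \<open>y\<close> in \<open>A\<close> and to its out-neighbours in \<open>B\<close>: a vertex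
  found there has its neighbours confined to one side of the cut and away from the neighbours of \<open>y\<close>
  of the opposite kind, which bounds \<open>|A|\<close> and \<open>|B|\<close> from below. If \<open>y\<close> has no out-neighbour in
  \<open>B\<close>, a vertex of \<open>B\<close> is used instead of \<open>y\<close>.
\<close>

section \<open>The short cycle constant is attained\<close>

definition nbrs_in :: "('a \<Rightarrow> 'a \<Rightarrow> bool) \<Rightarrow> 'a set \<Rightarrow> 'a \<Rightarrow> 'a set" where
  "nbrs_in E X v = {w \<in> X. E v w}"

text \<open>Vertices may coincide in both clauses, so the first one also excludes loops.\<close>

definition no_short_cycle :: "('a \<Rightarrow> 'a \<Rightarrow> bool) \<Rightarrow> 'a set \<Rightarrow> bool" where
  "no_short_cycle E X \<longleftrightarrow> (\<forall>u\<in>X. \<forall>v\<in>X. \<not> (E u v \<and> E v u)) \<and>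
     (\<forall>u\<in>X. \<forall>v\<in>X. \<forall>w\<in>X. \<not> (E u v \<and> E v w \<and> E w u))"

lemma finite_nbrs_in [simp]: "finite X \<Longrightarrow> finite (nbrs_in E X v)"
  by (simp add: nbrs_in_def)

lemma no_short_cycle_subset: "no_short_cycle E X \<Longrightarrow> Y \<subseteq> X \<Longrightarrow> no_short_cycle E Y"
  unfolding no_short_cycle_def by blast

lemma no_short_cycle_conversep: "no_short_cycle E\<inverse>\<inverse> X \<longleftrightarrow> no_short_cycle E X"
  unfolding no_short_cycle_def by blast

lemma card_nbrs_in_vimage:
  assumes "inj_on f X" "Y = f ` X" "v \<in> X"
  shows "card (nbrs_in E Y (f v)) = card (nbrs_in (\<lambda>x y. E (f x) (f y)) X v)"
proof -
  have "nbrs_in E Y (f v) = f ` nbrs_in (\<lambda>x y. E (f x) (f y)) X v"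
    using assms unfolding nbrs_in_def by blast
  moreover have "inj_on f (nbrs_in (\<lambda>x y. E (f x) (f y)) X v)"
    using assms(1) by (rule inj_on_subset) (auto simp: nbrs_in_def)
  ultimately show ?thesis by (simp add: card_image)
qed

lemma (in digraph) out_degree_eq_card_nbrs_in:
  "out_degree G v = card (nbrs_in (dominates G) (verts G) v)"
proof -
  have "inj_on (head G) (out_arcs G v)"
    by (rule inj_onI) (auto simp: arc_to_ends_def intro: no_multi_arcs)
  moreover have "head G ` out_arcs G v = nbrs_in (dominates G) (verts G) v"
    by (auto simp: nbrs_in_def arcs_ends_conv image_iff)
  ultimately show ?thesis unfolding out_degree_def by (metis card_image)
qed

lemma (in digraph) in_degree_eq_card_nbrs_in:
  "in_degree G v = card (nbrs_in (dominates G)\<inverse>\<inverse> (verts G) v)"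
proof -
  have "inj_on (tail G) (in_arcs G v)"
    by (rule inj_onI) (auto simp: arc_to_ends_def intro: no_multi_arcs)
  moreover have "tail G ` in_arcs G v = nbrs_in (dominates G)\<inverse>\<inverse> (verts G) v"
    by (auto simp: nbrs_in_def arcs_ends_conv image_iff)
  ultimately show ?thesis unfolding in_degree_def by (metis card_image)
qed

lemma (in digraph) digon_imp_cycle:
  assumes "u \<rightarrow> v" "v \<rightarrow> u"
  shows "\<exists>p. cycle p \<and> length p = 2"
proof -
  obtain e where e: "e \<in> arcs G" "tail G e = u" "head G e = v" using assms(1) by blast
  obtain f where f: "f \<in> arcs G" "tail G f = v" "head G f = u" using assms(2) by blast
  have "cycle [e, f]"
    unfolding cycle_def awalk_def using e f no_loops[OF e(1)] wellformed by (auto intro!: exI[of _ u])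
  then show ?thesis by (intro exI[of _ "[e, f]"]) auto
qed

lemma (in digraph) triangle_imp_cycle:
  assumes "u \<rightarrow> v" "v \<rightarrow> w" "w \<rightarrow> u"
  shows "\<exists>p. cycle p \<and> length p = 3"
proof -
  obtain e where e: "e \<in> arcs G" "tail G e = u" "head G e = v" using assms(1) by blast
  obtain f where f: "f \<in> arcs G" "tail G f = v" "head G f = w" using assms(2) by blast
  obtain g where g: "g \<in> arcs G" "tail G g = w" "head G g = u" using assms(3) by blast
  have "cycle [e, f, g]"
    unfolding cycle_def awalk_def
    using e f g no_loops[OF e(1)] no_loops[OF f(1)] no_loops[OF g(1)] wellformed
    by (auto intro!: exI[of _ u])
  then show ?thesis by (intro exI[of _ "[e, f, g]"]) auto
qed

lemma (in digraph) short_cycle_iff: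
  "(\<exists>p. cycle p \<and> length p \<le> 3) \<longleftrightarrow> \<not> no_short_cycle (dominates G) (verts G)"
proof
  assume "\<exists>p. cycle p \<and> length p \<le> 3"
  then obtain u p where p: "awalk u p u" "2 \<le> length p" "length p \<le> 3"
    by (auto simp: cycle_digraph_conv)
  have dom: "tail G a \<rightarrow> head G a" if "a \<in> arcs G" for a
    using that by (auto simp: arcs_ends_conv)
  \<comment> \<open>A digraph has no loops, so only the lengths 2 and 3 remain.\<close>
  consider e f where "p = [e, f]" | e f g where "p = [e, f, g]"
    using p(2,3) by (cases p; cases "tl p"; cases "tl (tl p)") auto
  then show "\<not> no_short_cycle (dominates G) (verts G)"
  proof cases
    case (1 e f)
    then have "u \<rightarrow> head G e" "head G e \<rightarrow> u" "u \<in> verts G" "head G e \<in> verts G"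
      using p(1) dom[of e] dom[of f] by (auto simp: awalk_def)
    then show ?thesis unfolding no_short_cycle_def by blast
  next
    case (2 e f g)
    then have "u \<rightarrow> head G e" "head G e \<rightarrow> head G f" "head G f \<rightarrow> u"
      "u \<in> verts G" "head G e \<in> verts G" "head G f \<in> verts G"
      using p(1) dom[of e] dom[of f] dom[of g] by (auto simp: awalk_def)
    then show ?thesis unfolding no_short_cycle_def by blast
  qed
next
  assume "\<not> no_short_cycle (dominates G) (verts G)"
  then consider u v where "u \<rightarrow> v" "v \<rightarrow> u" | u v w where "u \<rightarrow> v" "v \<rightarrow> w" "w \<rightarrow> u"
    unfolding no_short_cycle_def by blast
  then show "\<exists>p. cycle p \<and> length p \<le> 3"
  proof cases
    case 1
    from digon_imp_cycle[OF this] show ?thesis by (elim exE) (auto intro: exI)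
  next
    case 2
    from triangle_imp_cycle[OF this] show ?thesis by (elim exE) (auto intro: exI)
  qed
qed

lemma min_out_degree_ge_iff:
  assumes "finite (verts G)" "verts G \<noteq> {}"
  shows "r \<le> real (min_out_degree G) \<longleftrightarrow> (\<forall>v\<in>verts G. r \<le> real (out_degree G v))"
proof -
  have "Min (out_degree G ` verts G) \<in> out_degree G ` verts G"
    using assms by (intro Min_in) auto
  moreover have "Min (out_degree G ` verts G) \<le> out_degree G v" if "v \<in> verts G" for v
    using assms that by auto
  ultimately show ?thesis unfolding min_out_degree_def
    by (smt (verit) imageE of_nat_le_iff)
qed

text \<open>The contrapositive form supplies a vertex of small out-degree; it is the form later
  applied to the sides of a cut and to neighbourhoods.\<close>

lemma forces_short_cycle_iff:
  "forces_short_cycle x \<longleftrightarrow>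
    (\<forall>(V :: nat set) E. finite V \<and> V \<noteq> {} \<and> no_short_cycle E V \<longrightarrow>
      (\<exists>v\<in>V. real (card (nbrs_in E V v)) < x * real (card V)))"
  (is "_ \<longleftrightarrow> ?R")
proof
  assume F: "forces_short_cycle x"
  show ?R
  proof (intro allI impI)
    fix V :: "nat set" and E
    assume V: "finite V \<and> V \<noteq> {} \<and> no_short_cycle E V"
    define G where "G = \<lparr>verts = V, arcs = {(u, v). u \<in> V \<and> v \<in> V \<and> E u v}, tail = fst, head = snd\<rparr>"
    have "finite {(u, v). u \<in> V \<and> v \<in> V \<and> E u v}"
      by (rule finite_subset[of _ "V \<times> V"]) (use V in auto)
    moreover have "u \<noteq> v" if "u \<in> V" "E u v" for u v
      using V that unfolding no_short_cycle_def by blast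
    ultimately interpret digraph G
      using V by unfold_locales (auto simp: G_def arc_to_ends_def)
    have dom: "dominates G u v \<longleftrightarrow> u \<in> V \<and> v \<in> V \<and> E u v" for u v
      by (auto simp: arcs_ends_conv G_def image_iff)
    have "no_short_cycle (dominates G) V"
      using V unfolding no_short_cycle_def dom by blast
    then have "\<not> (\<exists>p. cycle p \<and> length p \<le> 3)"
      by (simp add: short_cycle_iff) (simp add: G_def)
    with F V have "\<not> x * real (card (verts G)) \<le> real (min_out_degree G)"
      unfolding forces_short_cycle_def using digraph_axioms by (auto simp: G_def)
    moreover have "verts G \<noteq> {}" using V by (simp add: G_def)
    ultimately obtain v where "v \<in> verts G" "real (out_degree G v) < x * real (card (verts G))"
      using min_out_degree_ge_iff[OF finite_verts, of "x * real (card (verts G))"]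
      by (meson not_le)
    moreover have "nbrs_in (dominates G) V v = nbrs_in E V v" if "v \<in> V"
      using that by (auto simp: nbrs_in_def dom)
    ultimately show "\<exists>v\<in>V. real (card (nbrs_in E V v)) < x * real (card V)"
      unfolding out_degree_eq_card_nbrs_in by (auto simp: G_def)
  qed
next
  assume R: ?R
  show "forces_short_cycle x"
    unfolding forces_short_cycle_def
  proof (intro allI impI, elim conjE)
    fix G :: "(nat, nat \<times> nat) pre_digraph"
    assume "digraph G" and ne: "verts G \<noteq> {}"
      and deg: "x * real (card (verts G)) \<le> real (min_out_degree G)"
    interpret digraph G by fact
    have "\<forall>v\<in>verts G. x * real (card (verts G)) \<le> real (card (nbrs_in (dominates G) (verts G) v))"
      using deg ne by (simp add: min_out_degree_ge_iff out_degree_eq_card_nbrs_in)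
    then have "\<not> no_short_cycle (dominates G) (verts G)"
      using R ne by (meson finite_verts linorder_not_less)
    then show "\<exists>p. cycle p \<and> length p \<le> 3"
      by (simp add: short_cycle_iff)
  qed
qed

text \<open>The definition speaks of vertices in \<open>nat\<close>; an enumeration of
  \<open>X\<close> by \<open>{..<card X}\<close> carries the property over to any finite
  set.\<close>

lemma forces_short_cycleD:
  fixes X :: "'a set"
  assumes "forces_short_cycle x" "finite X" "X \<noteq> {}" "no_short_cycle E X"
  shows "\<exists>v\<in>X. real (card (nbrs_in E X v)) < x * real (card X)"
proof -
  obtain f :: "nat \<Rightarrow> 'a" where f: "bij_betw f {..<card X} X"
    using ex_bij_betw_nat_finite[OF assms(2)] by (auto simp: atLeast0LessThan)
  then have inj: "inj_on f {..<card X}" and im: "X = f ` {..<card X}"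
    by (auto simp: bij_betw_def)
  let ?E = "\<lambda>i j. E (f i) (f j)"
  have "no_short_cycle ?E {..<card X}"
    using assms(4) im unfolding no_short_cycle_def by blast
  then obtain i where "i < card X" "real (card (nbrs_in ?E {..<card X} i)) < x * real (card X)"
    using assms(1,3) im unfolding forces_short_cycle_iff
    by (metis card_lessThan finite_lessThan image_empty lessThan_iff)
  then show ?thesis
    using card_nbrs_in_vimage[OF inj im, of i E] bij_betwE[OF f] by (intro bexI[of _ "f i"]) auto
qed

section \<open>Range of the forcing values and their minimum\<close>

text \<open>In the directed 4-cycle every out-degree is 1, a quarter of the order. By monotonicity
  the forcing values are thus bounded below by a positive number.\<close>

lemma not_forces_quarter: "\<not> forces_short_cycle (1 / 4)"
proof
  let ?E = "\<lambda>i j :: nat. j = (i + 1) mod 4"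
  assume "forces_short_cycle (1 / 4)"
  moreover have "no_short_cycle ?E {..<4}"
    unfolding no_short_cycle_def by (auto simp: mod_Suc)
  moreover have "nbrs_in ?E {..<4} i = {(i + 1) mod 4}" for i
    by (auto simp: nbrs_in_def)
  ultimately show False
    using forces_short_cycleD[of "1/4" "{..<4::nat}" ?E] by (auto simp: lessThan_empty_iff)
qed

lemma forces_short_cycle_mono:
  assumes "forces_short_cycle x" "x \<le> y"
  shows "forces_short_cycle y"
  unfolding forces_short_cycle_iff
proof (intro allI impI, elim conjE)
  fix V :: "nat set" and E
  assume "finite V" "V \<noteq> {}" "no_short_cycle E V"
  from forces_short_cycleD[OF assms(1) this]
  show "\<exists>v\<in>V. real (card (nbrs_in E V v)) < y * real (card V)"
    using assms(2) by (meson less_le_trans mult_right_mono of_nat_0_le_iff)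
qed

text \<open>An out-degree never reaches twice the order. This makes the set of forcing values
  nonempty, as its infimum requires.\<close>

lemma forces_short_cycle_2: "forces_short_cycle 2"
  unfolding forces_short_cycle_iff
proof (intro allI impI, elim conjE)
  fix V :: "nat set" and E
  assume V: "finite V" "V \<noteq> {}"
  then obtain v where "v \<in> V" by blast
  have "card (nbrs_in E V v) \<le> card V" "card V > 0"
    using V by (auto simp: nbrs_in_def card_gt_0_iff intro: card_mono)
  then show "\<exists>v\<in>V. real (card (nbrs_in E V v)) < 2 * real (card V)"
    using \<open>v \<in> V\<close> by (intro bexI[of _ v]) auto
qed

definition lex_square :: "('a \<Rightarrow> 'a \<Rightarrow> bool) \<Rightarrow> 'a \<times> 'a \<Rightarrow> 'a \<times> 'a \<Rightarrow> bool" where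
  "lex_square E p q \<longleftrightarrow> E (fst p) (fst q) \<or> fst p = fst q \<and> E (snd p) (snd q)"

text \<open>Project a short cycle to its first coordinates. Either all of them agree and the second
  coordinates form a short cycle, or deleting the stationary steps leaves a cycle of length 2 or 3
  in \<open>E\<close>.\<close>

lemma no_short_cycle_lex_square:
  assumes "no_short_cycle E X"
  shows "no_short_cycle (lex_square E) (X \<times> X)"
proof -
  have asym: "E u v \<Longrightarrow> E v u \<Longrightarrow> False" if "u \<in> X" "v \<in> X" for u v
    using assms that unfolding no_short_cycle_def by blast
  have no3: "E u v \<Longrightarrow> E v w \<Longrightarrow> E w u \<Longrightarrow> False" if "u \<in> X" "v \<in> X" "w \<in> X" for u v w
    using assms that unfolding no_short_cycle_def by blast
  show ?thesis
    unfolding no_short_cycle_def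
  proof (intro conjI ballI notI)
    fix p q assume "p \<in> X \<times> X" "q \<in> X \<times> X" "lex_square E p q \<and> lex_square E q p"
    then show False
      using asym[of "fst p" "fst q"] asym[of "snd p" "snd q"]
      unfolding lex_square_def mem_Times_iff by metis
  next
    fix p q r assume "p \<in> X \<times> X" "q \<in> X \<times> X" "r \<in> X \<times> X"
      "lex_square E p q \<and> lex_square E q r \<and> lex_square E r p"
    then show False
      using no3[of "fst p" "fst q" "fst r"] no3[of "snd p" "snd q" "snd r"]
        asym[of "fst p" "fst q"] asym[of "fst q" "fst r"] asym[of "fst r" "fst p"]
      unfolding lex_square_def mem_Times_iff by metis
  qed
qed

lemma card_nbrs_in_lex_square:
  assumes "finite X" "no_short_cycle E X" "p \<in> X \<times> X"
  shows "card (nbrs_in (lex_square E) (X \<times> X) p) =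
    card (nbrs_in E X (fst p)) * card X + card (nbrs_in E X (snd p))"
proof -
  have "nbrs_in (lex_square E) (X \<times> X) p =
      nbrs_in E X (fst p) \<times> X \<union> {fst p} \<times> nbrs_in E X (snd p)"
    using assms(3) by (auto simp: nbrs_in_def lex_square_def)
  \<comment> \<open>The two parts are disjoint because \<open>E\<close> has no loops on
    \<open>X\<close>.\<close>
  moreover have "nbrs_in E X (fst p) \<times> X \<inter> {fst p} \<times> nbrs_in E X (snd p) = {}"
    using assms(2,3) by (auto simp: nbrs_in_def no_short_cycle_def)
  ultimately show ?thesis
    using assms(1) by (simp add: card_Un_disjoint card_cartesian_product)
qed

text \<open>The infimum is attained since the lexicographic square of a counterexample for it would have
  a strictly larger ratio of out-degree to order.\<close>

lemma forces_short_cycle_Inf: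
  "forces_short_cycle (Inf {x. forces_short_cycle x})" (is "forces_short_cycle ?c")
proof -
  have quarter: "1 / 4 < x" if "forces_short_cycle x" for x
    using that not_forces_quarter forces_short_cycle_mono[of x "1/4"] by fastforce
  have ne: "{x. forces_short_cycle x} \<noteq> {}" using forces_short_cycle_2 by blast
  have c: "1 / 4 \<le> ?c"
    by (rule cInf_greatest[OF ne]) (auto dest: quarter)
  have above: "forces_short_cycle y" if "?c < y" for y
    using cInf_lessD[OF ne that] forces_short_cycle_mono by auto
  show ?thesis
  proof (rule forces_short_cycle_iff[THEN iffD2], intro allI impI, elim conjE, rule ccontr)
    fix V :: "nat set" and E
    assume V: "finite V" "V \<noteq> {}" "no_short_cycle E V"
      and "\<not> (\<exists>v\<in>V. real (card (nbrs_in E V v)) < ?c * real (card V))"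
    then have deg: "?c * real (card V) \<le> real (card (nbrs_in E V v))" if "v \<in> V" for v
      using that by fastforce
    let ?n = "real (card V)"
    have n: "?n > 0" using V by (simp add: card_gt_0_iff)
    \<comment> \<open>This is the ratio (c n * n + c n) / n^2 that the square is sure to reach. It
      exceeds the infimum since c > 0, hence it forces a short cycle.\<close>
    define y where "y = ?c + ?c / ?n"
    have "?c < y" using n c by (simp add: y_def)
    have "finite (V \<times> V)" "V \<times> V \<noteq> {}" using V by auto
    from forces_short_cycleD[OF above[OF \<open>?c < y\<close>] this no_short_cycle_lex_square[OF V(3)]]
    obtain p where p: "p \<in> V \<times> V"
      and less: "real (card (nbrs_in (lex_square E) (V \<times> V) p)) < y * (?n * ?n)"
      by (auto simp: card_cartesian_product)
    have "y * (?n * ?n) = ?c * ?n * ?n + ?c * ?n"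
      using n by (simp add: y_def field_simps)
    also have "\<dots> \<le> real (card (nbrs_in E V (fst p))) * ?n + real (card (nbrs_in E V (snd p)))"
      using p n by (intro add_mono mult_right_mono deg) auto
    also have "\<dots> = real (card (nbrs_in (lex_square E) (V \<times> V) p))"
      using card_nbrs_in_lex_square[OF V(1,3) p] by simp
    finally show False using less by simp
  qed
qed

text \<open>\<open>LEAST\<close> on the reals is meaningful only where a minimum exists; attainment
  identifies it with the infimum.\<close>

lemma forces_short_cycle_short_cycle_const: "forces_short_cycle short_cycle_const"
proof -
  have "1 / 4 \<le> x" if "forces_short_cycle x" for x
    using that not_forces_quarter forces_short_cycle_mono[of x "1/4"] by fastforce
  then have "bdd_below {x. forces_short_cycle x}"
    by (intro bdd_belowI[of _ "1/4"]) auto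
  then have "Inf {x. forces_short_cycle x} \<le> y" if "forces_short_cycle y" for y
    using that by (auto intro: cInf_lower)
  then show ?thesis
    unfolding short_cycle_const_def using forces_short_cycle_Inf by (metis Least_equality)
qed

section \<open>Cuts in triangle-free oriented graphs\<close>

lemma card_nbrs_in_Un:
  assumes "finite X" "finite Y" "X \<inter> Y = {}"
  shows "card (nbrs_in E (X \<union> Y) v) = card (nbrs_in E X v) + card (nbrs_in E Y v)"
proof -
  have "nbrs_in E (X \<union> Y) v = nbrs_in E X v \<union> nbrs_in E Y v"
    by (auto simp: nbrs_in_def)
  then show ?thesis
    using assms by (simp add: card_Un_disjoint nbrs_in_def disjoint_iff)
qed

locale triangle_free_cut =
  fixes A S B :: "'a set" and E :: "'a \<Rightarrow> 'a \<Rightarrow> bool" and d :: nat and c :: real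
  assumes finite: "finite A" "finite S" "finite B"
    and disjoint: "A \<inter> S = {}" "A \<inter> B = {}" "S \<inter> B = {}"
    and nonempty: "A \<noteq> {}" "B \<noteq> {}"
    and no_back: "\<lbrakk>x \<in> B; y \<in> A\<rbrakk> \<Longrightarrow> \<not> E x y"
    and no_short: "no_short_cycle E (A \<union> S \<union> B)"
    and out_deg: "v \<in> A \<union> S \<union> B \<Longrightarrow> d \<le> card (nbrs_in E (A \<union> S \<union> B) v)"
    and in_deg: "v \<in> A \<union> S \<union> B \<Longrightarrow> d \<le> card (nbrs_in E\<inverse>\<inverse> (A \<union> S \<union> B) v)"
    and forces: "forces_short_cycle c"
    and c_bounds: "0 < c" "c < 1"
begin

text \<open>Reversing all arcs exchanges the two sides, so each bound for \<open>A\<close> and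
  in-neighbours yields one for \<open>B\<close> and out-neighbours.\<close>

lemma dual: "triangle_free_cut B S A E\<inverse>\<inverse> d c"
  using finite disjoint nonempty no_back no_short out_deg in_deg forces c_bounds
  by unfold_locales (auto simp: no_short_cycle_conversep Un_ac)

lemma asym: "\<lbrakk>E u v; E v u; u \<in> A \<union> S \<union> B; v \<in> A \<union> S \<union> B\<rbrakk> \<Longrightarrow> False"
  using no_short unfolding no_short_cycle_def by blast

lemma no_triangle:
  "\<lbrakk>E u v; E v w; E w u; u \<in> A \<union> S \<union> B; v \<in> A \<union> S \<union> B; w \<in> A \<union> S \<union> B\<rbrakk> \<Longrightarrow> False"
  using no_short unfolding no_short_cycle_def by blast

lemma ex_small_out:
  assumes "X \<subseteq> A \<union> S \<union> B" "X \<noteq> {}"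
  shows "\<exists>v\<in>X. real (card (nbrs_in E X v)) < c * real (card X)"
  using forces_short_cycleD[OF forces _ assms(2) no_short_cycle_subset[OF no_short assms(1)]]
    finite_subset[OF assms(1)] finite by blast

lemma ex_small_in:
  assumes "X \<subseteq> A \<union> S \<union> B" "X \<noteq> {}"
  shows "\<exists>v\<in>X. real (card (nbrs_in E\<inverse>\<inverse> X v)) < c * real (card X)"
  using triangle_free_cut.ex_small_out[OF dual] assms by (simp add: Un_ac)

lemma out_deg_split:
  assumes "v \<in> A \<union> S \<union> B"
  shows "real d \<le> real (card (nbrs_in E A v)) + real (card (nbrs_in E S v)) + real (card (nbrs_in E B v))"
  using out_deg[OF assms] finite disjoint
  by (simp add: card_nbrs_in_Un Int_Un_distrib2 flip: of_nat_add of_nat_le_iff)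

lemma in_deg_split:
  assumes "v \<in> A \<union> S \<union> B"
  shows "real d \<le> real (card (nbrs_in E\<inverse>\<inverse> A v)) + real (card (nbrs_in E\<inverse>\<inverse> S v))
    + real (card (nbrs_in E\<inverse>\<inverse> B v))"
  using triangle_free_cut.out_deg_split[OF dual, of v] assms by (simp add: Un_ac add_ac)

lemma no_in_from_B: "y \<in> A \<Longrightarrow> nbrs_in E\<inverse>\<inverse> B y = {}"
  using no_back by (auto simp: nbrs_in_def)

lemma no_out_to_A: "x \<in> B \<Longrightarrow> nbrs_in E A x = {}"
  using no_back by (auto simp: nbrs_in_def)

lemma card_nbrs_in_S_le: "card (nbrs_in F S v) \<le> card S"
  using finite by (auto simp: nbrs_in_def intro: card_mono)

section \<open>Lower bounds on the size of a cut\<close>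

text \<open>A vertex of \<open>A\<close> has all its in-neighbours in \<open>A\<close> and
  \<open>S\<close>. Choosing one with few of them in \<open>A\<close> gives d < c |A| + |S|; the
  mirrored bound for \<open>B\<close> is added.\<close>

lemma cut_bound_linear: "2 * real d < c * (real (card A) + real (card B)) + 2 * real (card S)"
proof -
  obtain y where y: "y \<in> A" "real (card (nbrs_in E\<inverse>\<inverse> A y)) < c * real (card A)"
    using ex_small_in[of A] nonempty by blast
  obtain x where x: "x \<in> B" "real (card (nbrs_in E B x)) < c * real (card B)"
    using ex_small_out[of B] nonempty by blast
  have "real d \<le> real (card (nbrs_in E\<inverse>\<inverse> A y)) + real (card S)"
    using in_deg_split[of y] card_nbrs_in_S_le[of "E\<inverse>\<inverse>" y] no_in_from_B[OF y(1)] y(1) by simp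
  moreover have "real d \<le> real (card (nbrs_in E B x)) + real (card S)"
    using out_deg_split[of x] card_nbrs_in_S_le[of E x] no_out_to_A[OF x(1)] x(1) by simp
  ultimately show ?thesis using x(2) y(2) by (simp add: algebra_simps)
qed

text \<open>Among the in-neighbours \<open>?I\<close> of \<open>v\<close> pick \<open>w\<close> with
  fewer than c |?I| in-neighbours there. More than d - c |?I| vertices then lie outside
  \<open>?I\<close> and the out-neighbours \<open>?O\<close>, and both sets have at least d
  elements. This settles the quadratic bound for cuts of size at least d.\<close>

lemma order_lower_bound: "(3 - c) * real d < real (card A) + real (card S) + real (card B)"
proof -
  let ?V = "A \<union> S \<union> B"
  obtain v where v: "v \<in> ?V" using nonempty by blast
  let ?I = "nbrs_in E\<inverse>\<inverse> ?V v" and ?O = "nbrs_in E ?V v"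
  have finV: "finite ?V" using finite by simp
  show ?thesis
  proof (cases "?I = {}")
    case True
    then have "d = 0" using in_deg[OF v] by simp
    then show ?thesis using nonempty finite by (simp add: card_gt_0_iff add_pos_nonneg)
  next
    case False
    have "?I \<subseteq> ?V" by (auto simp: nbrs_in_def)
    then obtain w where w: "w \<in> ?I" "real (card (nbrs_in E\<inverse>\<inverse> ?I w)) < c * real (card ?I)"
      using ex_small_in False by blast
    have wV: "w \<in> ?V" and wv: "E w v" using w(1) by (auto simp: nbrs_in_def)
    \<comment> \<open>An in-neighbour of \<open>w\<close> in \<open>?O\<close> would close a
      triangle through \<open>w\<close> and \<open>v\<close>.\<close>
    have "nbrs_in E\<inverse>\<inverse> ?V w \<subseteq> nbrs_in E\<inverse>\<inverse> ?I w \<union> (?V - ?I - ?O)"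
      using no_triangle[OF _ _ wv v _ wV] by (auto simp: nbrs_in_def)
    then have "card (nbrs_in E\<inverse>\<inverse> ?V w) \<le> card (nbrs_in E\<inverse>\<inverse> ?I w \<union> (?V - ?I - ?O))"
      using finV by (intro card_mono) auto
    also have "\<dots> \<le> card (nbrs_in E\<inverse>\<inverse> ?I w) + card (?V - ?I - ?O)"
      by (rule card_Un_le)
    finally have "d \<le> card (nbrs_in E\<inverse>\<inverse> ?I w) + card (?V - ?I - ?O)"
      using in_deg[OF wV] by linarith
    moreover have "card ?V = card ?I + card ?O + card (?V - ?I - ?O)"
    proof -
      have "?I \<inter> ?O = {}" using asym v by (auto simp: nbrs_in_def)
      then have "card (?I \<union> ?O) = card ?I + card ?O"
        using finV by (simp add: card_Un_disjoint)
      moreover have "card ?V = card (?I \<union> ?O) + card (?V - (?I \<union> ?O))"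
        using finV by (subst card_Un_disjoint[symmetric]) (auto simp: nbrs_in_def intro: arg_cong[where f = card])
      ultimately show ?thesis by (simp add: Diff_Un Diff_Int2 set_diff_eq)
    qed
    moreover have "card ?V = card A + card S + card B"
      using finite disjoint by (simp add: card_Un_disjoint Int_Un_distrib2)
    moreover have "d \<le> card ?O" "d \<le> card ?I" using out_deg[OF v] in_deg[OF v] by auto
    moreover have "(1 - c) * real d \<le> (1 - c) * real (card ?I)"
      using \<open>d \<le> card ?I\<close> c_bounds by (intro mult_left_mono) auto
    ultimately show ?thesis using w(2) by (simp add: algebra_simps)
  qed
qed

text \<open>An in-neighbour of \<open>y\<close> in \<open>A\<close> receives arcs only from \<open>A \<union> S\<close>, and none from an
  out-neighbour of \<open>y\<close>.\<close>

lemma card_A_gt: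
  assumes "y \<in> A \<union> S \<union> B" "nbrs_in E\<inverse>\<inverse> A y \<noteq> {}"
  shows "real d + real (card (nbrs_in E A y)) + real (card (nbrs_in E S y))
      + (1 - c) * real (card (nbrs_in E\<inverse>\<inverse> A y)) < real (card A) + real (card S)"
proof -
  let ?R = "nbrs_in E\<inverse>\<inverse> A y" and ?P = "nbrs_in E A y" and ?Q = "nbrs_in E S y"
  have "?R \<subseteq> A \<union> S \<union> B" by (auto simp: nbrs_in_def)
  \<comment> \<open>The choice of \<open>w\<close> leaves at least (1 - c) |?R| elements of
    \<open>?R\<close> that are not in-neighbours of \<open>w\<close>.\<close>
  then obtain w where w: "w \<in> ?R" "real (card (nbrs_in E\<inverse>\<inverse> ?R w)) < c * real (card ?R)"
    using ex_small_in assms(2) by blast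
  have wA: "w \<in> A" and wy: "E w y" using w(1) by (auto simp: nbrs_in_def)
  have sub: "nbrs_in E\<inverse>\<inverse> (A \<union> S \<union> B) w \<subseteq> nbrs_in E\<inverse>\<inverse> ?R w \<union> ((A - ?R - ?P) \<union> (S - ?Q))"
    using no_triangle[OF _ _ wy assms(1)] wA no_back[OF _ wA] by (auto simp: nbrs_in_def)
  have "d \<le> card (nbrs_in E\<inverse>\<inverse> (A \<union> S \<union> B) w)" using in_deg wA by blast
  also have "\<dots> \<le> card (nbrs_in E\<inverse>\<inverse> ?R w \<union> ((A - ?R - ?P) \<union> (S - ?Q)))"
    using finite sub by (intro card_mono) auto
  also have "\<dots> \<le> card (nbrs_in E\<inverse>\<inverse> ?R w) + (card (A - ?R - ?P) + card (S - ?Q))"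
    by (meson add_left_mono card_Un_le order_trans)
  finally have "d \<le> card (nbrs_in E\<inverse>\<inverse> ?R w) + (card (A - ?R - ?P) + card (S - ?Q))" .
  moreover have "card A = card ?R + card ?P + card (A - ?R - ?P)"
  proof -
    have "?R \<inter> ?P = {}" using asym assms(1) by (auto simp: nbrs_in_def)
    then have "card (?R \<union> ?P) = card ?R + card ?P"
      using finite by (simp add: card_Un_disjoint)
    moreover have "card A = card (?R \<union> ?P) + card (A - (?R \<union> ?P))"
      using finite by (subst card_Un_disjoint[symmetric]) (auto simp: nbrs_in_def intro: arg_cong[where f = card])
    moreover have "A - (?R \<union> ?P) = A - ?R - ?P" by blast
    ultimately show ?thesis by simp
  qed
  moreover have "card S = card ?Q + card (S - ?Q)"
    using finite by (subst card_Un_disjoint[symmetric]) (auto simp: nbrs_in_def intro: arg_cong[where f = card])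
  ultimately show ?thesis using w(2) by (simp add: algebra_simps)
qed

lemma card_B_gt:
  assumes "x \<in> A \<union> S \<union> B" "nbrs_in E B x \<noteq> {}"
  shows "real d + real (card (nbrs_in E\<inverse>\<inverse> B x)) + real (card (nbrs_in E\<inverse>\<inverse> S x))
      + (1 - c) * real (card (nbrs_in E B x)) < real (card B) + real (card S)"
  using triangle_free_cut.card_A_gt[OF dual, of x] assms by (simp add: Un_ac)

text \<open>Weight \<open>1 - c\<close> on the sum of the bounds for \<open>A\<close> and \<open>B\<close> and weight \<open>c\<close> on the one for \<open>B\<close>
  make the number of out-neighbours of \<open>y\<close> in \<open>B\<close> cancel.\<close>

lemma cut_bound_quadratic_if_crossing:
  assumes "card S < d" "y \<in> A" "real (card (nbrs_in E\<inverse>\<inverse> A y)) < c * real (card A)"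
    and "nbrs_in E B y \<noteq> {}"
  shows "(5 - 4 * c + c\<^sup>2) * real d
    < real (card A) + real (card S) + real (card B) + (1 - c) * (2 - c) * real (card S)"
proof -
  define a b k where "a = real (card A)" and "b = real (card B)" and "k = real (card S)"
  define iA iS oA oS oB
    where "iA = real (card (nbrs_in E\<inverse>\<inverse> A y))" and "iS = real (card (nbrs_in E\<inverse>\<inverse> S y))"
      and "oA = real (card (nbrs_in E A y))" and "oS = real (card (nbrs_in E S y))"
      and "oB = real (card (nbrs_in E B y))"
  note defs = a_def b_def k_def iA_def iS_def oA_def oS_def oB_def
  let ?d = "real d"
  have y: "y \<in> A \<union> S \<union> B" using assms(2) by blast
  have i: "?d \<le> iA + iS"
    using in_deg_split[OF y] no_in_from_B[OF assms(2)] by (simp add: defs)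
  have iS: "iS \<le> k" using card_nbrs_in_S_le by (simp add: defs)
  have o: "?d \<le> oA + oS + oB" using out_deg_split[OF y] by (simp add: defs)
  \<comment> \<open>Since k < d, the set \<open>S\<close> cannot hold all in-neighbours of
    \<open>y\<close>; this makes the bound for \<open>A\<close> applicable.\<close>
  have "iA > 0" using i iS assms(1) by (simp add: defs)
  then have A: "?d + oA + oS + (1 - c) * iA < a + k"
    using card_A_gt[OF y] by (simp add: defs card_gt_0_iff)
  have B: "?d + iS + (1 - c) * oB < b + k"
    using card_B_gt[OF y assms(4)] no_in_from_B[OF assms(2)] by (simp add: defs)
  have ca: "iA < c * a" using assms(3) by (simp add: defs)
  \<comment> \<open>Add \<open>A\<close> and \<open>B\<close> and insert oA + oS \<ge> d - oB and iS
    \<ge> d - iA.\<close>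
  have "(1 - c) * (4 * ?d - c * (iA + oB)) \<le> (1 - c) * (a + b + 2 * k)"
    using A B i o c_bounds by (intro mult_left_mono) (auto simp: algebra_simps)
  moreover have "c * (2 * ?d - iA + (1 - c) * oB) \<le> c * (b + k)"
    using B i c_bounds by (intro mult_left_mono) auto
  \<comment> \<open>With \<open>oB\<close> cancelled, iA < c a completes (1 - c) a to a and leaves
    the coefficient (1 - c)^2 on \<open>iA\<close>, to which iA \<ge> d - k is applied.\<close>
  moreover have "(1 - c)\<^sup>2 * (?d - k) \<le> (1 - c)\<^sup>2 * iA"
    using i iS by (intro mult_left_mono) auto
  ultimately have "(5 - 4 * c + c\<^sup>2) * ?d < a + k + b + (1 - c) * (2 - c) * k"
    using ca by (simp add: algebra_simps power2_eq_square)
  then show ?thesis by (simp add: defs)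
qed

lemma cut_bound_quadratic:
  "(5 - 4 * c + c\<^sup>2) * real d
    < real (card A) + real (card S) + real (card B) + (1 - c) * (2 - c) * real (card S)"
proof (cases "card S < d")
  case False
  \<comment> \<open>Here 5 - 4 c + c^2 = (3 - c) + (1 - c)(2 - c), so the bound on the order covers
    the rest.\<close>
  then have "(1 - c) * (2 - c) * real d \<le> (1 - c) * (2 - c) * real (card S)"
    using c_bounds by (intro mult_left_mono) auto
  then show ?thesis using order_lower_bound by (simp add: algebra_simps power2_eq_square)
next
  case True
  obtain y where y: "y \<in> A" "real (card (nbrs_in E\<inverse>\<inverse> A y)) < c * real (card A)"
    using ex_small_in[of A] nonempty by blast
  obtain x where x: "x \<in> B" "real (card (nbrs_in E B x)) < c * real (card B)"
    using ex_small_out[of B] nonempty by blast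
  consider "nbrs_in E B y \<noteq> {}" | "nbrs_in E\<inverse>\<inverse> A x \<noteq> {}"
    | "nbrs_in E B y = {}" "nbrs_in E\<inverse>\<inverse> A x = {}" by blast
  then show ?thesis
  proof cases
    case 1
    then show ?thesis using cut_bound_quadratic_if_crossing True y by blast
  next
    case 2
    then show ?thesis
      using triangle_free_cut.cut_bound_quadratic_if_crossing[OF dual True x(1)] x(2) by simp
  next
    case 3
    have yV: "y \<in> A \<union> S \<union> B" and xV: "x \<in> A \<union> S \<union> B" using x y by auto
    have iA: "real d \<le> real (card (nbrs_in E\<inverse>\<inverse> A y)) + real (card S)"
      using in_deg_split[OF yV] card_nbrs_in_S_le[of "E\<inverse>\<inverse>" y] no_in_from_B[OF y(1)] by simp
    have oB: "real d \<le> real (card (nbrs_in E B x)) + real (card S)"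
      using out_deg_split[OF xV] card_nbrs_in_S_le[of E x] no_out_to_A[OF x(1)] by simp
    have "nbrs_in E\<inverse>\<inverse> A y \<noteq> {}" "nbrs_in E B x \<noteq> {}"
      using iA oB True by auto
    \<comment> \<open>No out-neighbour of \<open>y\<close> lies in \<open>B\<close>, so all d of
      them count in the bound for \<open>A\<close>; likewise for the in-neighbours of
      \<open>x\<close> and \<open>B\<close>.\<close>
    then have "2 * real d + (1 - c) * real (card (nbrs_in E\<inverse>\<inverse> A y)) < real (card A) + real (card S)"
      and "2 * real d + (1 - c) * real (card (nbrs_in E B x)) < real (card B) + real (card S)"
      using card_A_gt[OF yV] card_B_gt[OF xV] out_deg_split[OF yV] in_deg_split[OF xV] 3 by auto
    moreover have "(1 - c) * (real d - real (card S)) \<le> (1 - c) * real (card (nbrs_in E\<inverse>\<inverse> A y))"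
      "(1 - c) * (real d - real (card S)) \<le> (1 - c) * real (card (nbrs_in E B x))"
      using iA oB c_bounds by (auto intro!: mult_left_mono)
    \<comment> \<open>These two terms are exactly the surplus of the summed bounds over the
      claim.\<close>
    moreover have "0 \<le> (1 + (1 - c) * c) * (real d - real (card S))" "0 \<le> c * real d"
      using True c_bounds by (auto intro!: mult_nonneg_nonneg add_nonneg_nonneg)
    ultimately show ?thesis by (simp add: algebra_simps power2_eq_square)
  qed
qed

end

section \<open>Existence of a minimum cut\<close>

text \<open>At most one arc joins \<open>u\<close> and \<open>v\<close>, so one of them cannot reach
  the other. This bounds the connectivity strictly below the order.\<close>

lemma (in oriented_graph) disconnects_all_but_two:
  assumes "u \<in> verts G" "v \<in> verts G" "u \<noteq> v"
  shows "disconnects G (verts G - {u, v})"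
proof -
  have W: "verts G - (verts G - {u, v}) = {u, v}" using assms by auto
  have arc: "x \<rightarrow> y" if xy: "x \<rightarrow>\<^sup>*\<^bsub>G \<restriction> {u, v}\<^esub> y" "x \<noteq> y" "{x, y} = {u, v}" for x y
  proof -
    obtain z where "x \<rightarrow>\<^bsub>G \<restriction> {u, v}\<^esub> z" "z \<rightarrow>\<^sup>*\<^bsub>G \<restriction> {u, v}\<^esub> y"
      using xy(1,2) by (blast elim: pre_digraph.converse_reachable_cases)
    then have "x \<rightarrow> z" "z \<in> {u, v}"
      by (auto dest: dominates_induce_subgraphD elim: reachable_in_vertsE)
    moreover from this have "z \<noteq> x" using adj_not_same by blast
    ultimately show ?thesis using xy(2,3) by auto
  qed
  have "\<not> strongly_connected (G \<restriction> {u, v})"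
    using arc[of u v] arc[of v u] not_both_arcs[OF assms] assms(3)
    by (auto simp: strongly_connected_def)
  then show ?thesis by (simp add: disconnects_def W)
qed

lemma (in oriented_graph) minimum_cut:
  assumes "2 \<le> card (verts G)"
  obtains A S B where "verts G = A \<union> S \<union> B" "A \<inter> S = {}" "A \<inter> B = {}" "S \<inter> B = {}"
    "A \<noteq> {}" "B \<noteq> {}" "\<And>x y. x \<in> B \<Longrightarrow> y \<in> A \<Longrightarrow> \<not> x \<rightarrow> y" "card S = strong_connectivity G"
proof -
  let ?C = "{S. disconnects G S}"
  have fin: "finite ?C"
    by (rule finite_subset[of _ "Pow (verts G)"]) (auto simp: disconnects_def)
  obtain u v where uv: "u \<in> verts G" "v \<in> verts G" "u \<noteq> v"
    using assms card_le_Suc0_iff_eq[of "verts G"] by fastforce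
  note two = disconnects_all_but_two[OF uv]
  have "strong_connectivity G \<in> card ` ?C"
    unfolding strong_connectivity_def using fin two by (intro Min_in) auto
  then obtain S where S: "disconnects G S" "card S = strong_connectivity G" by auto
  let ?H = "G \<restriction> (verts G - S)"
  \<comment> \<open>The null digraph also fails to be strongly connected, so
    \<open>S = verts G\<close> has to be ruled out before an unreachable pair can be chosen.\<close>
  have "strong_connectivity G \<le> card (verts G - {u, v})"
    unfolding strong_connectivity_def using fin two by (intro Min_le) auto
  also have "\<dots> < card (verts G)"
    using uv by (intro psubset_card_mono) auto
  finally have "S \<noteq> verts G" using S(2) by auto
  then have "verts G - S \<noteq> {}" using S(1) by (auto simp: disconnects_def)
  then obtain x y where xy: "x \<in> verts G - S" "y \<in> verts G - S" "\<not> x \<rightarrow>\<^sup>*\<^bsub>?H\<^esub> y"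
    using S(1) by (auto simp: disconnects_def strongly_connected_def)
  interpret H: wf_digraph ?H by (rule wellformed_induce_subgraph)
  \<comment> \<open>Everything reachable from \<open>x\<close> outside \<open>S\<close> is closed
    under arcs outside \<open>S\<close>, so no arc leaves it for the remaining part
    \<open>A\<close>, which contains \<open>y\<close>.\<close>
  define B where "B = {z. x \<rightarrow>\<^sup>*\<^bsub>?H\<^esub> z}"
  define A where "A = verts G - S - B"
  have B: "B \<subseteq> verts G - S" by (auto simp: B_def elim: reachable_in_vertsE)
  have "x \<in> B" "y \<in> A" using xy H.reachable_refl by (auto simp: A_def B_def)
  moreover have "\<not> p \<rightarrow> q" if "p \<in> B" "q \<in> A" for p q
  proof
    assume "p \<rightarrow> q"
    then have "p \<rightarrow>\<^bsub>?H\<^esub> q"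
      using that B by (auto simp: A_def arcs_ends_conv image_iff)
    then have "q \<in> B"
      using that(1) H.reachable_adj_trans by (auto simp: B_def)
    then show False using that(2) by (simp add: A_def)
  qed
  ultimately show thesis
    using that[of A S B] S B by (auto simp: A_def disconnects_def)
qed

section \<open>From the two cut bounds to a directed triangle\<close>

theorem theorem1p3:
  fixes D :: "('a, 'b) pre_digraph" and d :: nat and m c :: real
  defines "c \<equiv> short_cycle_const"
  assumes "oriented_graph D"
    and "d \<ge> 1"
    and "min_semi_degree D = d"
    and "real (card (verts D)) = m * real d"
    and "2.91082 < m" and "m < 2 / c"
    and "real (strong_connectivity D)
      \<le> max ((5 - m - 4 * c + c\<^sup>2) / ((1 - c) * (2 - c)) * real d) ((2 - c * m) / (2 - c) * real d)"
  shows "has_directed_triangle D"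
proof (rule ccontr)
  assume no_triangle: "\<not> has_directed_triangle D"
  interpret oriented_graph D by fact
  let ?E = "dominates D" and ?d = "real d"
  have m: "2 < m" using assms(6) by simp
  \<comment> \<open>For c \<le> 0 the quotient 2 / c is at most 0, also at c = 0 where division
    yields 0; this contradicts 2 < m < 2 / c. Then 2 c < c m < 2 gives c < 1.\<close>
  have c0: "0 < c"
    using m assms(7) divide_nonneg_nonpos[of 2 c] by linarith
  then have "c * 2 < c * m" "c * m < 2"
    using m assms(7) by (auto simp: field_simps)
  then have c1: "c < 1" by simp
  have "2 * ?d < m * ?d" using assms(3) m by (intro mult_strict_right_mono) auto
  then have "real (2 * d) < real (card (verts D))" using assms(5) by simp
  then have card2: "2 \<le> card (verts D)" using assms(3) unfolding of_nat_less_iff by linarith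
  have no_short: "no_short_cycle ?E (verts D)"
    unfolding no_short_cycle_def
  proof (intro conjI ballI notI)
    fix u v assume "u \<in> verts D" "v \<in> verts D" "?E u v \<and> ?E v u"
    then show False using not_both_arcs adj_not_same by metis
  next
    fix u v w assume "?E u v \<and> ?E v w \<and> ?E w u"
    then show False
      using triangle_imp_cycle[of u v w] no_triangle by (auto simp: has_directed_triangle_def)
  qed
  have deg: "d \<le> card (nbrs_in ?E (verts D) v)" "d \<le> card (nbrs_in ?E\<inverse>\<inverse> (verts D) v)"
    if "v \<in> verts D" for v
  proof -
    have "min_out_degree D \<le> out_degree D v" "min_in_degree D \<le> in_degree D v"
      unfolding min_out_degree_def min_in_degree_def using that by auto
    then show "d \<le> card (nbrs_in ?E (verts D) v)" "d \<le> card (nbrs_in ?E\<inverse>\<inverse> (verts D) v)"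
      using assms(4) by (simp_all add: min_semi_degree_def out_degree_eq_card_nbrs_in
        in_degree_eq_card_nbrs_in)
  qed
  obtain A S B where V: "verts D = A \<union> S \<union> B"
    and cut: "A \<inter> S = {}" "A \<inter> B = {}" "S \<inter> B = {}" "A \<noteq> {}" "B \<noteq> {}"
      "\<And>x y. x \<in> B \<Longrightarrow> y \<in> A \<Longrightarrow> \<not> ?E x y"
    and k: "card S = strong_connectivity D"
    by (rule minimum_cut[OF card2]) (rule that)
  have fin: "finite A" "finite S" "finite B" using finite_verts unfolding V by auto
  have "forces_short_cycle c" unfolding c_def by (rule forces_short_cycle_short_cycle_const)
  then interpret cut: triangle_free_cut A S B ?E d c
    using cut fin no_short[unfolded V] deg[unfolded V] c0 c1 by unfold_locales
  let ?k = "real (strong_connectivity D)"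
  have n: "real (card A) + ?k + real (card B) = m * ?d"
    using assms(5) fin cut k unfolding V by (simp add: card_Un_disjoint Int_Un_distrib2)
  \<comment> \<open>Substituting |A| + |S| + |B| = m d moves m to the left; both cut bounds then say
    that \<open>?k\<close> strictly exceeds each term of the maximum.\<close>
  have "(5 - m - 4 * c + c\<^sup>2) * ?d < ?k * ((1 - c) * (2 - c))"
    using cut.cut_bound_quadratic n k by (simp add: algebra_simps)
  then have "(5 - m - 4 * c + c\<^sup>2) / ((1 - c) * (2 - c)) * ?d < ?k"
    using c1 by (simp add: pos_divide_less_eq)
  moreover have AB: "real (card A) + real (card B) = m * ?d - ?k" using n by simp
  have "(2 - c * m) * ?d < ?k * (2 - c)"
    using cut.cut_bound_linear unfolding AB k by (simp add: algebra_simps)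
  then have "(2 - c * m) / (2 - c) * ?d < ?k"
    using c1 by (simp add: pos_divide_less_eq)
  ultimately show False using assms(8) by simp
qed

end
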